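(* Let $\mathcal{F}$ be a union-closed family of finite sets with $\emptyset\in\mathcal{F}$ and with at least two members, and suppose $\mathcal{F}$ is graph generated, i.e. every member of $G(\mathcal{F})$ has exactly one or exactly two elements. Then there is a set $U\in G(\mathcal{F})$ such that $|\mathcal{F}_{\supseteq U}|/|\mathcal{F}|\le 1/2$, where $\mathcal{F}_{\supseteq U}=\{V\in\mathcal{F}: V\supseteq U\}$.
   Context: For a union-closed family $\mathcal{F}$ containing $\emptyset$, $G(\mathcal{F})$ denotes its set of union generators: the nonempty members $V\in\mathcal{F}$ that are not equal to the union of the members of $\mathcal{F}$ properly contained in $V$. Every member of $\mathcal{F}$ is a union of members of $G(\mathcal{F})$, and no member of $G(\mathcal{F})$ is a union of other members of $G(\mathcal{F})$. *)

theory Defs imports Complex_Main begin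

definition union_closed :: "'a set set \<Rightarrow> bool" where
  "union_closed F \<longleftrightarrow> (\<forall>A\<in>F. \<forall>B\<in>F. A \<union> B \<in> F)"

definition union_generators :: "'a set set \<Rightarrow> 'a set set" where
  "union_generators F = {V \<in> F. V \<noteq> {} \<and> V \<noteq> \<Union>{W \<in> F. W \<subset> V}}"

definition graph_generated :: "'a set set \<Rightarrow> bool" where
  "graph_generated F \<longleftrightarrow> (\<forall>V\<in>union_generators F. card V = 1 \<or> card V = 2)"

definition supersets_in :: "'a set set \<Rightarrow> 'a set \<Rightarrow> 'a set set" where
  "supersets_in F U = {V \<in> F. U \<subseteq> V}"

end

theory Submission imports Defs begin

text \<open>
  View the members of size two as the edges of a graph and the members \<open>{x}\<close> as loops: \<open>S\<close> is in the
  family iff every vertex of \<open>S\<close> has a loop or a neighbour in \<open>S\<close>. For an edge \<open>uv\<close> with \<open>v\<close> loopless,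
  deleting \<open>v\<close>, or \<open>u\<close>, or both, maps the members containing \<open>u, v\<close> injectively to members missing one
  of them, except for those in which some \<open>z \<noteq> u\<close> hangs on \<open>v\<close> (\<open>v\<close> is the only neighbour of \<open>z\<close>). On the other
  side, members in which \<open>v\<close> hangs on \<open>z\<close> give, after deletion of \<open>v\<close>, unused members that avoid \<open>u, v\<close>
  and meet the neighbourhood of \<open>v\<close> in exactly \<open>z\<close>. So it suffices that, summed over \<open>z \<noteq> u\<close>, \<open>v\<close> hangs
  on \<open>z\<close> at least as often as \<open>z\<close> hangs on \<open>v\<close>. Summed over all ordered pairs the two counts agree, so a
  suitable loopless \<open>v\<close> exists, and then a suitable neighbour \<open>u\<close> can be discarded.
\<close>

definition nbrs :: "'a set set \<Rightarrow> 'a \<Rightarrow> 'a set" where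
  "nbrs F x = {y. y \<noteq> x \<and> {x, y} \<in> F}"

lemma mem_nbrs_commute: "y \<in> nbrs F x \<longleftrightarrow> x \<in> nbrs F y"
  by (auto simp: nbrs_def insert_commute)

text \<open>The last conjunct excludes the case where \<open>z\<close> and \<open>v\<close> hang on
  each other. This exclusion is symmetric in \<open>z\<close> and \<open>v\<close>, and it ensures
  that deleting a hanging vertex from \<open>S\<close> does not strand the vertex it hangs
  on.\<close>

definition hanging :: "'a set set \<Rightarrow> 'a \<Rightarrow> 'a \<Rightarrow> 'a set set" where
  "hanging F z v = {S \<in> F. z \<in> S \<and> {z} \<notin> F \<and> nbrs F z \<inter> S = {v}
     \<and> \<not> ({v} \<notin> F \<and> nbrs F v \<inter> S = {z})}"

lemma hanging_imp_nbr: "S \<in> hanging F z v \<Longrightarrow> z \<in> nbrs F v"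
  using mem_nbrs_commute by (fastforce simp: hanging_def)

lemma card_le_of_remove:
  assumes "finite B" and "\<And>S. S \<in> A \<Longrightarrow> R \<subseteq> S \<and> S - R \<in> B"
  shows "card A \<le> card B"
proof (rule card_inj_on_le)
  show "inj_on (\<lambda>S. S - R) A"
    using assms(2) by (intro inj_onI) blast
qed (use assms in auto)

text \<open>Discarding a nonpositive term cannot lower the sum; if there is none, all terms are
  positive and any one may go.\<close>

lemma ex_sum_remove_nonneg:
  fixes f :: "'a \<Rightarrow> int"
  assumes "finite A" "A \<noteq> {}" "sum f A \<ge> 0"
  shows "\<exists>u\<in>A. sum f (A - {u}) \<ge> 0"
proof (cases "\<exists>u\<in>A. f u \<le> 0")
  case True
  then show ?thesis using assms by (force simp: sum_diff1)
next
  case False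
  then show ?thesis using assms(2) by (metis Diff_iff ex_in_conv le_cases sum_nonneg)
qed

lemma generator_subset:
  assumes "finite V" "V \<in> F" "x \<in> V"
  shows "\<exists>W\<in>union_generators F. x \<in> W \<and> W \<subseteq> V"
  using assms
proof (induction V rule: finite_psubset_induct)
  case (psubset V)
  show ?case
  proof (cases "V \<in> union_generators F")
    case False
    then have "V = \<Union>{W \<in> F. W \<subset> V}"
      using psubset.prems by (auto simp: union_generators_def)
    then obtain W where "W \<in> F" "W \<subset> V" "x \<in> W"
      using psubset.prems by blast
    then show ?thesis using psubset.IH[of W] by blast
  qed (use psubset.prems in auto)
qed

lemma graph_generated_nbr:
  assumes "graph_generated F" "finite S" "S \<in> F" "x \<in> S" "{x} \<notin> F"
  shows "nbrs F x \<inter> S \<noteq> {}"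
proof -
  obtain W where W: "W \<in> union_generators F" "x \<in> W" "W \<subseteq> S"
    using generator_subset assms by metis
  then have "W \<in> F" "card W = 1 \<or> card W = 2"
    using assms(1) by (auto simp: union_generators_def graph_generated_def)
  with W assms(5) obtain y where "y \<noteq> x" "W = {x, y}"
    by (fastforce simp: card_1_singleton_iff card_2_iff doubleton_eq_iff)
  with \<open>W \<in> F\<close> W(3) show ?thesis by (auto simp: nbrs_def)
qed

lemma union_closed_Union:
  assumes "union_closed F" "{} \<in> F" "finite X" "X \<subseteq> F"
  shows "\<Union>X \<in> F"
  using assms(3,4) by (induction X rule: finite_induct) (use assms(1,2) in \<open>auto simp: union_closed_def\<close>)

text \<open>\<open>mem_iff\<close> condenses union closure, the empty member and graph generation
  into a local condition at each vertex; the counting below rests on it and on finiteness.\<close>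

locale graph_family =
  fixes F :: "'a set set"
  assumes finite_family: "finite F"
    and finite_vertices: "finite (\<Union>F)"
    and mem_iff: "S \<in> F \<longleftrightarrow> (\<forall>x\<in>S. {x} \<in> F \<or> nbrs F x \<inter> S \<noteq> {})"
begin

lemma finite_nbrs: "finite (nbrs F x)"
  by (rule finite_subset[OF _ finite_vertices]) (auto simp: nbrs_def)

text \<open>By \<open>mem_iff\<close>, deleting \<open>v\<close> fails only if some loopless vertex
  thereby loses its last neighbour.\<close>

lemma not_mem_remove:
  assumes "S \<in> F" "S - {v} \<notin> F"
  obtains z where "z \<in> S" "z \<noteq> v" "{z} \<notin> F" "nbrs F z \<inter> S = {v}"
proof -
  obtain z where z: "z \<in> S - {v}" "{z} \<notin> F" "nbrs F z \<inter> (S - {v}) = {}"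
    using assms(2) mem_iff[of "S - {v}"] by auto
  moreover have "nbrs F z \<inter> S \<noteq> {}"
    using assms(1) z mem_iff[of S] by auto
  ultimately show thesis by (intro that[of z]) auto
qed

lemma card_supersets_edge_le:
  assumes v: "{v} \<notin> F" and u: "u \<in> nbrs F v"
    and balance: "(\<Sum>z\<in>nbrs F v - {u}. card (hanging F z v)) \<le> (\<Sum>z\<in>nbrs F v - {u}. card (hanging F v z))"
  shows "2 * card (supersets_in F {u, v}) \<le> card F"
proof -
  define X where "X = supersets_in F {u, v}"
  \<comment> \<open>\<open>X1\<close>, \<open>X2\<close>, \<open>X3\<close> allow deletion of
    \<open>v\<close>, \<open>u\<close> or both; \<open>X4\<close> holds the exceptions. The targets
    \<open>Y1\<close> to \<open>Y4\<close> lie outside \<open>X\<close> and are disjoint: the trace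
    on \<open>nbrs F v\<close> is empty in \<open>Y3\<close> and a singleton in
    \<open>Y4\<close>.\<close>
  define X1 where "X1 = {S \<in> X. S - {v} \<in> F}"
  define X2 where "X2 = {S \<in> X. S - {u} \<in> F}"
  define X3 where "X3 = {S \<in> X. S - {u, v} \<in> F \<and> nbrs F v \<inter> S = {u}}"
  define X4 where "X4 = (\<Union>z\<in>nbrs F v - {u}. hanging F z v)"
  define Y1 where "Y1 = {S \<in> F. u \<in> S \<and> v \<notin> S}"
  define Y2 where "Y2 = {S \<in> F. u \<notin> S \<and> v \<in> S}"
  define Y3 where "Y3 = {S \<in> F. u \<notin> S \<and> v \<notin> S \<and> nbrs F v \<inter> S = {}}"
  define Z where "Z z = {S \<in> F. u \<notin> S \<and> v \<notin> S \<and> nbrs F v \<inter> S = {z}}" for z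
  define Y4 where "Y4 = (\<Union>z\<in>nbrs F v - {u}. Z z)"
  note defs = X_def X1_def X2_def X3_def X4_def Y1_def Y2_def Y3_def Z_def Y4_def supersets_in_def
  have sub: "X \<subseteq> F" "X1 \<subseteq> F" "X2 \<subseteq> F" "X3 \<subseteq> F" "X4 \<subseteq> F"
    "Y1 \<subseteq> F" "Y2 \<subseteq> F" "Y3 \<subseteq> F" "Y4 \<subseteq> F" "\<And>z. Z z \<subseteq> F"
    by (auto simp: defs hanging_def)
  note fin = sub[THEN finite_subset[OF _ finite_family]]
  have uv: "u \<noteq> v" using u by (simp add: nbrs_def)

  have cover: "X \<subseteq> X1 \<union> X2 \<union> X3 \<union> X4"
  proof
    fix S assume S: "S \<in> X"
    then have SF: "S \<in> F" and uS: "u \<in> S" and vS: "v \<in> S" by (auto simp: defs)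
    show "S \<in> X1 \<union> X2 \<union> X3 \<union> X4"
    proof (rule ccontr)
      assume no: "S \<notin> X1 \<union> X2 \<union> X3 \<union> X4"
      \<comment> \<open>The last conjunct of \<open>hanging\<close> is automatic here:
        \<open>u\<close> is a neighbour of \<open>v\<close> in \<open>S\<close> other than
        \<open>z\<close>.\<close>
      have only_u: "z = u" if "z \<in> S" "{z} \<notin> F" "nbrs F z \<inter> S = {v}" for z
      proof (rule ccontr)
        assume "z \<noteq> u"
        then have "S \<in> hanging F z v"
          using that SF uS u by (auto simp: hanging_def)
        with \<open>z \<noteq> u\<close> no show False by (auto simp: X4_def dest: hanging_imp_nbr)
      qed
      have "S - {v} \<notin> F" using no S by (auto simp: X1_def)
      then obtain z where "z \<in> S" "{z} \<notin> F" "nbrs F z \<inter> S = {v}"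
        using not_mem_remove[OF SF] by metis
      then have u_leaf: "{u} \<notin> F" "nbrs F u \<inter> S = {v}" using only_u by auto
      have "S - {u} \<notin> F" using no S by (auto simp: X2_def)
      then obtain w where w: "w \<in> S" "w \<noteq> u" "{w} \<notin> F" "nbrs F w \<inter> S = {u}"
        using not_mem_remove[OF SF] by metis
      then have "w \<in> nbrs F u" using mem_nbrs_commute by fast
      with w u_leaf have "w = v" by auto
      with w have v_leaf: "nbrs F v \<inter> S = {u}" by simp
      \<comment> \<open>Within \<open>S\<close>, \<open>u\<close> and \<open>v\<close> are adjacent
        only to each other, so deleting both costs no other vertex a neighbour.\<close>
      have "S - {u, v} \<in> F"
      proof (subst mem_iff, intro ballI)
        fix x assume x: "x \<in> S - {u, v}"
        then have "x \<notin> nbrs F u" "x \<notin> nbrs F v" using u_leaf v_leaf by auto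
        then have "u \<notin> nbrs F x" "v \<notin> nbrs F x" using mem_nbrs_commute by metis+
        then show "{x} \<in> F \<or> nbrs F x \<inter> (S - {u, v}) \<noteq> {}"
          using SF mem_iff[of S] x by auto
      qed
      with v_leaf no S show False by (auto simp: X3_def)
    qed
  qed
  have c1: "card X1 \<le> card Y1"
    by (rule card_le_of_remove[where R = "{v}"]) (use fin uv in \<open>auto simp: defs\<close>)
  have c2: "card X2 \<le> card Y2"
    by (rule card_le_of_remove[where R = "{u}"]) (use fin uv in \<open>auto simp: defs\<close>)
  have c3: "card X3 \<le> card Y3"
    by (rule card_le_of_remove[where R = "{u, v}"]) (use fin uv in \<open>auto simp: defs\<close>)
  \<comment> \<open>Only a vertex hanging on \<open>v\<close> could block the deletion of
    \<open>v\<close>. It would have to be \<open>z\<close>, the sole neighbour of \<open>v\<close>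
    in \<open>S\<close>, and mutual hanging is excluded.\<close>
  have cz: "card (hanging F v z) \<le> card (Z z)" if z: "z \<in> nbrs F v - {u}" for z
  proof (rule card_le_of_remove[where R = "{v}"])
    fix S assume S: "S \<in> hanging F v z"
    then have SF: "S \<in> F" and vS: "v \<in> S" and leaf: "nbrs F v \<inter> S = {z}"
      and nl: "\<not> ({z} \<notin> F \<and> nbrs F z \<inter> S = {v})" by (auto simp: hanging_def)
    have "S - {v} \<in> F"
    proof (rule ccontr)
      assume "S - {v} \<notin> F"
      then obtain w where w: "w \<in> S" "{w} \<notin> F" "nbrs F w \<inter> S = {v}"
        using not_mem_remove[OF SF] by metis
      then have "w \<in> nbrs F v" using mem_nbrs_commute by fast
      with w leaf nl show False by auto
    qed
    moreover have "nbrs F v \<inter> (S - {v}) = {z}"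
      using leaf by (auto simp: nbrs_def)
    moreover have "u \<notin> S" using leaf z u by (metis Diff_iff IntI singletonD singletonI)
    ultimately show "{v} \<subseteq> S \<and> S - {v} \<in> Z z"
      using vS by (simp add: Z_def)
  qed (use fin in auto)
  have "card X4 \<le> (\<Sum>z\<in>nbrs F v - {u}. card (hanging F z v))"
    unfolding X4_def by (rule card_UN_le) (simp add: finite_nbrs)
  also note balance
  also have "(\<Sum>z\<in>nbrs F v - {u}. card (hanging F v z)) \<le> (\<Sum>z\<in>nbrs F v - {u}. card (Z z))"
    by (rule sum_mono) (rule cz)
  also have "\<dots> = card Y4"
    unfolding Y4_def
    by (rule card_UN_disjoint[symmetric]) (use finite_nbrs fin in \<open>auto simp: Z_def\<close>)
  finally have c4: "card X4 \<le> card Y4" .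

  have "card X \<le> card (X1 \<union> X2 \<union> X3 \<union> X4)"
    by (rule card_mono) (use fin cover in auto)
  also have "\<dots> \<le> card X1 + card X2 + card X3 + card X4"
    using card_Un_le[of "X1 \<union> X2 \<union> X3" X4] card_Un_le[of "X1 \<union> X2" X3] card_Un_le[of X1 X2]
    by linarith
  also have "\<dots> \<le> card Y1 + card Y2 + card Y3 + card Y4"
    using c1 c2 c3 c4 by linarith
  also have "\<dots> = card (Y1 \<union> Y2 \<union> Y3 \<union> Y4)"
  proof -
    have "Y1 \<inter> Y2 = {}" "(Y1 \<union> Y2) \<inter> Y3 = {}" "(Y1 \<union> Y2 \<union> Y3) \<inter> Y4 = {}"
      by (auto simp: defs)
    then show ?thesis using fin by (simp add: card_Un_disjoint)
  qed
  also have "\<dots> \<le> card (F - X)"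
    by (rule card_mono) (use finite_family sub in \<open>auto simp: defs\<close>)
  also have "\<dots> = card F - card X"
    using sub fin by (simp add: card_Diff_subset)
  finally show ?thesis
    using card_mono[OF finite_family sub(1)] by (simp add: X_def)
qed

text \<open>The difference \<open>D\<close> is antisymmetric, so its total over all pairs is 0. A
  looped \<open>v\<close> never hangs and contributes at most 0; were every loopless vertex
  negative, \<open>w\<close> would make the total negative.\<close>

lemma ex_balanced_vertex:
  assumes "w \<in> \<Union>F" "{w} \<notin> F"
  obtains v where "v \<in> \<Union>F" "{v} \<notin> F"
    "(\<Sum>z\<in>nbrs F v. int (card (hanging F v z)) - int (card (hanging F z v))) \<ge> 0"
proof -
  define D where "D v z = int (card (hanging F v z)) - int (card (hanging F z v))" for v z
  have D0: "D v z = 0" if "z \<notin> nbrs F v" for v z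
  proof -
    have "hanging F v z = {}" "hanging F z v = {}"
      using that hanging_imp_nbr mem_nbrs_commute by (metis equals0I)+
    then show ?thesis by (simp add: D_def)
  qed
  \<comment> \<open>Extending the sum to all vertices makes both index sets equal, so that the
    double sum can be swapped.\<close>
  have eq: "sum (D v) (\<Union>F) = sum (D v) (nbrs F v)" for v
    by (rule sum.mono_neutral_right[OF finite_vertices]) (auto simp: nbrs_def intro!: D0)
  have "(\<Sum>v\<in>\<Union>F. sum (D v) (\<Union>F)) = 0"
    unfolding D_def sum_subtractf by (subst (2) sum.swap) simp
  moreover have "sum (D v) (\<Union>F) \<le> 0" if "{v} \<in> F" for v
  proof -
    have "hanging F v z = {}" for z using that by (auto simp: hanging_def)
    then show ?thesis by (intro sum_nonpos) (simp add: D_def)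
  qed
  ultimately have "\<exists>v\<in>\<Union>F. {v} \<notin> F \<and> sum (D v) (\<Union>F) \<ge> 0"
  proof -
    assume total: "(\<Sum>v\<in>\<Union>F. sum (D v) (\<Union>F)) = 0"
      and looped: "\<And>v. {v} \<in> F \<Longrightarrow> sum (D v) (\<Union>F) \<le> 0"
    show ?thesis
    proof (rule ccontr)
      assume "\<not> ?thesis"
      then have neg: "sum (D v) (\<Union>F) < 0" if "v \<in> \<Union>F" "{v} \<notin> F" for v
        using that by (meson not_le)
      then have "sum (D v) (\<Union>F) \<le> 0" if "v \<in> \<Union>F" for v
        using that looped[of v] by (cases "{v} \<in> F") (auto intro: less_imp_le)
      then have "(\<Sum>v\<in>\<Union>F. sum (D v) (\<Union>F)) < (\<Sum>v\<in>\<Union>F. 0)"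
        using neg assms by (intro sum_strict_mono_ex1[OF finite_vertices]) blast+
      with total show False by simp
    qed
  qed
  then show thesis using that eq unfolding D_def by auto
qed

lemma ex_generator_card_le:
  assumes "\<Union>F \<noteq> {}"
  shows "\<exists>U\<in>union_generators F. 2 * card (supersets_in F U) \<le> card F"
proof (cases "\<exists>w\<in>\<Union>F. {w} \<notin> F")
  case True
  then obtain v where v: "v \<in> \<Union>F" "{v} \<notin> F"
    "(\<Sum>z\<in>nbrs F v. int (card (hanging F v z)) - int (card (hanging F z v))) \<ge> 0"
    using ex_balanced_vertex by metis
  have "nbrs F v \<noteq> {}" using v mem_iff by blast
  then obtain u where u: "u \<in> nbrs F v"
    and "(\<Sum>z\<in>nbrs F v - {u}. int (card (hanging F v z)) - int (card (hanging F z v))) \<ge> 0"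
    using ex_sum_remove_nonneg[OF finite_nbrs _ v(3)] by metis
  then have "2 * card (supersets_in F {u, v}) \<le> card F"
    by (intro card_supersets_edge_le[OF v(2) u])
      (simp add: sum_subtractf flip: of_nat_sum)
  \<comment> \<open>As \<open>v\<close> is loopless, no member properly inside \<open>{u, v}\<close>
    covers \<open>v\<close>.\<close>
  moreover have "{u, v} \<in> union_generators F"
  proof -
    have "v \<notin> W" if "W \<in> F" "W \<subset> {u, v}" for W
    proof
      assume "v \<in> W"
      with that(2) have "W = {v}" by auto
      with that(1) v(2) show False by simp
    qed
    then have "{u, v} \<noteq> \<Union>{W \<in> F. W \<subset> {u, v}}" by blast
    then show ?thesis using u by (auto simp: union_generators_def nbrs_def insert_commute)
  qed
  ultimately show ?thesis by blast
next
  \<comment> \<open>Every vertex has a loop, so by \<open>mem_iff\<close> deleting \<open>x\<close>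
    always leaves a member.\<close>
  case False
  obtain x where x: "x \<in> \<Union>F" using assms by blast
  with False have "{x} \<in> F" by blast
  moreover have "\<Union>{W \<in> F. W \<subset> {x}} = {}" by auto
  ultimately have gen: "{x} \<in> union_generators F" by (auto simp: union_generators_def)
  let ?X = "supersets_in F {x}"
  have sub: "?X \<subseteq> F" by (auto simp: supersets_in_def)
  have "card ?X \<le> card (F - ?X)"
  proof (rule card_le_of_remove[where R = "{x}"])
    fix S assume "S \<in> ?X"
    then show "{x} \<subseteq> S \<and> S - {x} \<in> F - ?X"
      using False mem_iff[of "S - {x}"] by (auto simp: supersets_in_def)
  qed (use finite_family in auto)
  also have "\<dots> = card F - card ?X"
    using sub finite_family by (simp add: card_Diff_subset finite_subset)
  finally have "2 * card ?X \<le> card F"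
    using card_mono[OF finite_family sub] by linarith
  with gen show ?thesis by blast
qed

end

theorem theorem3p1:
  fixes F :: "'a set set"
  assumes "finite F"
    and "\<forall>V\<in>F. finite V"
    and "union_closed F"
    and "{} \<in> F"
    and "card F \<ge> 2"
    and "graph_generated F"
  shows "\<exists>U\<in>union_generators F.
    real (card (supersets_in F U)) / real (card F) \<le> 1 / 2"
proof -
  have fin: "finite (\<Union>F)" using assms(1,2) by blast
  interpret graph_family F
  proof
    fix S :: "'a set"
    show "S \<in> F \<longleftrightarrow> (\<forall>x\<in>S. {x} \<in> F \<or> nbrs F x \<inter> S \<noteq> {})"
    proof
      assume "S \<in> F"
      then show "\<forall>x\<in>S. {x} \<in> F \<or> nbrs F x \<inter> S \<noteq> {}"
        using graph_generated_nbr[OF assms(6)] assms(2) by blast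
    next
      assume R: "\<forall>x\<in>S. {x} \<in> F \<or> nbrs F x \<inter> S \<noteq> {}"
      \<comment> \<open>The witness \<open>W\<close> is the loop \<open>{x}\<close> or an edge from
        \<open>x\<close> to a neighbour in \<open>S\<close>.\<close>
      then have "\<forall>x\<in>S. \<exists>W\<in>F. x \<in> W \<and> W \<subseteq> S" by (fastforce simp: nbrs_def)
      then have "S = \<Union>{W \<in> F. W \<subseteq> S}" by blast
      moreover have "\<Union>{W \<in> F. W \<subseteq> S} \<in> F"
        using union_closed_Union[OF assms(3,4), of "{W \<in> F. W \<subseteq> S}"] assms(1) by auto
      ultimately show "S \<in> F" by simp
    qed
  qed (use assms(1) fin in auto)
  have "\<Union>F \<noteq> {}"
  proof
    assume "\<Union>F = {}"
    then have "F \<subseteq> {{}}" by auto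
    then have "card F \<le> card {{} :: 'a set}" by (intro card_mono) auto
    with assms(5) show False by simp
  qed
  then obtain U where "U \<in> union_generators F" "2 * card (supersets_in F U) \<le> card F"
    using ex_generator_card_le by blast
  with assms(5) show ?thesis by (intro bexI[of _ U]) (auto simp: field_simps simp flip: of_nat_mult)
qed

end
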